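(* Let $n\in\mathbb{N}$. The mapping $\mathbf{G}:\mathbb{D}_n\to\mathbb{G}_n$ defined by $\mathbf{G}(\mathcal{K}) := \mathcal{K}^{\bullet}\cap\mathbb{T}_{n,n}$ is a bijection, whose inverse is given by $\mathbf{G}^{-1}(\mathcal{P}) := \mathcal{P}^{\lozenge}$ for every $\mathcal{P}\in\mathbb{G}_n$.
   Context: Let $N=\{1,\dots,n\}$; elements of $\mathbb{R}^n$ are column vectors and $0_n$ is the zero vector. For $g,f\in\mathbb{R}^n$: $g\le f$ means $g_i\le f_i$ for all $i\in N$; $g<f$ (equivalently $f>g$) means $g\le f$ and $g\ne f$ (so $g>0_n$ means that $g$ is componentwise non-negative and nonzero). The lexicographic order: $g<_L f$ (equivalently $f>_L g$) if $g\neq f$ and $g_k<f_k$ for $k=\min\{i\in N: g_i\ne f_i\}$; $g\le_L f$ if $g<_L f$ or $g=f$. $\mathbb{D}_n$ is the family of all coherent sets of desirable gambles, i.e. all $\mathcal{K}\subset\mathbb{R}^n$ such that: (A1) $g,f\in\mathcal{K}$ implies $g+f\in\mathcal{K}$; (A2) $g\in\mathcal{K}$ and $\lambda>0$ imply $\lambda g\in\mathcal{K}$; (A3) $g>0_n$ implies $g\in\mathcal{K}$; (A4) $0_n\notin\mathcal{K}$. $\mathbb{M}_{n,n}$ is the space of real $n\times n$ matrices. $\mathbb{T}_{n,n}\subset\mathbb{M}_{n,n}$ is the set of full-rank stochastic matrices, i.e. full-rank matrices each of whose rows is a probability mass function (non-negative entries summing to $1$). Polarity operators: for $\mathcal{K}\subset\mathbb{R}^n$,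 $\mathcal{K}^{\bullet}:=\{A\in\mathbb{M}_{n,n}: Ag>_L 0_n \text{ for all } g\in\mathcal{K}\}$; for $\mathcal{A}\subset\mathbb{M}_{n,n}$, $\mathcal{A}^{\lozenge}:=\{g\in\mathbb{R}^n: Ag>_L 0_n\text{ for all }A\in\mathcal{A}\}$. A set $\mathcal{A}\subset\mathbb{M}_{n,n}$ is an $L$-convex cone (omitting its apex) if $\mathcal{A}=\{A\in\mathbb{M}_{n,n}: Ag^t>_L 0_n,\ t\in T\}$ for some arbitrary index set $T$ and vectors $g^t\in\mathbb{R}^n$, $t\in T$. A nonempty subset of $\mathbb{M}_{n,n}$ is an $L$-credal set if it is the intersection with $\mathbb{T}_{n,n}$ of some $L$-convex cone in $\mathbb{M}_{n,n}$. $\mathbb{G}_n$ is the family of all $L$-credal sets. *)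

theory Defs
  imports "HOL-Analysis.Analysis"
begin

text \<open>
  The index set \<open>N = {1, ..., n}\<close> is rendered as an arbitrary type \<open>'n\<close> that is finite and
  linearly ordered: up to the unique order isomorphism these types are exactly the chains
  \<open>1 < 2 < ... < n\<close> with \<open>n \<ge> 1\<close> (each \<open>n\<close> occurs, e.g. as the numeral type of size \<open>n\<close>). The
  order on \<open>'n\<close> is needed for the lexicographic comparison. Gambles are vectors of type
  \<open>real ^ 'n\<close>, matrices have type \<open>real ^ 'n ^ 'n\<close>. On vectors, the library's \<open>g \<le> f\<close> is the
  componentwise order and \<open>g < f\<close> means \<open>g \<le> f\<close> and \<open>g \<noteq> f\<close>.
\<close>

definition lex_less :: "real ^ 'n::{finite,linorder} \<Rightarrow> real ^ 'n::{finite,linorder} \<Rightarrow> bool"  (infix "<\<^sub>L" 50)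
  where "g <\<^sub>L f \<longleftrightarrow>
    g \<noteq> f \<and> (let k = Min {i. g $ i \<noteq> f $ i} in g $ k < f $ k)"

abbreviation lex_greater :: "real ^ 'n::{finite,linorder} \<Rightarrow> real ^ 'n::{finite,linorder} \<Rightarrow> bool"  (infix ">\<^sub>L" 50)
  where "f >\<^sub>L g \<equiv> g <\<^sub>L f"

definition coherent :: "(real ^ 'n::finite) set \<Rightarrow> bool"
  where "coherent K \<longleftrightarrow>
    (\<forall>g\<in>K. \<forall>f\<in>K. g + f \<in> K) \<and>
    (\<forall>g\<in>K. \<forall>c::real. c > 0 \<longrightarrow> c *\<^sub>R g \<in> K) \<and>
    (\<forall>g. g > 0 \<longrightarrow> g \<in> K) \<and>
    0 \<notin> K"

definition coherent_sets :: "(real ^ 'n::finite) set set"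
  where "coherent_sets = {K. coherent K}"

definition full_rank_stochastic :: "(real ^ 'n::finite ^ 'n::finite) set"
  where "full_rank_stochastic =
    {A. rank A = CARD('n) \<and> (\<forall>i. (\<forall>j. 0 \<le> A $ i $ j) \<and> (\<Sum>j\<in>UNIV. A $ i $ j) = 1)}"

definition polar_matrices ::
    "(real ^ 'n::{finite,linorder}) set \<Rightarrow> (real ^ 'n::{finite,linorder} ^ 'n::{finite,linorder}) set"  ("_\<^sup>\<bullet>" [1000] 999)
  where "K\<^sup>\<bullet> = {A. \<forall>g\<in>K. A *v g >\<^sub>L 0}"

definition polar_gambles ::
    "(real ^ 'n::{finite,linorder} ^ 'n::{finite,linorder}) set \<Rightarrow> (real ^ 'n::{finite,linorder}) set"  ("_\<^sup>\<lozenge>" [1000] 999)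
  where "\<A>\<^sup>\<lozenge> = {g. \<forall>A\<in>\<A>. A *v g >\<^sub>L 0}"

text \<open>
  An arbitrary family of vectors \<open>(g\<^sup>t)\<close>, \<open>t \<in> T\<close>, enters the next definition only through its
  range, so it is given by an arbitrary (possibly empty or infinite) set \<open>S\<close> of vectors; this
  avoids a spurious restriction to one particular type of indices.
\<close>

definition L_convex_cone :: "(real ^ 'n::{finite,linorder} ^ 'n::{finite,linorder}) set \<Rightarrow> bool"
  where "L_convex_cone \<A> \<longleftrightarrow>
    (\<exists>S :: (real ^ 'n::{finite,linorder}) set. \<A> = {A. \<forall>g\<in>S. A *v g >\<^sub>L 0})"

definition L_credal_set :: "(real ^ 'n::{finite,linorder} ^ 'n::{finite,linorder}) set \<Rightarrow> bool"
  where "L_credal_set \<P> \<longleftrightarrow>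
    \<P> \<noteq> {} \<and> (\<exists>\<A>. L_convex_cone \<A> \<and> \<P> = \<A> \<inter> full_rank_stochastic)"

definition L_credal_sets :: "(real ^ 'n::{finite,linorder} ^ 'n::{finite,linorder}) set set"
  where "L_credal_sets = {\<P>. L_credal_set \<P>}"

definition credal_map ::
    "(real ^ 'n::{finite,linorder}) set \<Rightarrow> (real ^ 'n::{finite,linorder} ^ 'n::{finite,linorder}) set"
  where "credal_map K = K\<^sup>\<bullet> \<inter> full_rank_stochastic"

end

theory Submission
  imports Defs
begin

text \<open>
  That the lozenge of an \<open>L\<close>-credal set is coherent, and that applying \<open>credal_map\<close> to it gives the
  set back, is the formal part: lexicographic positivity is a cone condition, a
  non-negative matrix of full rank maps \<open>g > 0\<close> to a non-negative nonzero vector, and the vectors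
  defining the \<open>L\<close>-convex cone lie in the lozenge (\<open>coherent_polar_gambles\<close>,
  \<open>credal_map_polar_gambles\<close>).

  The content is the bipolar identity \<open>(credal_map K)\<^sup>\<lozenge> = K\<close> together with
  \<open>credal_map K \<noteq> {}\<close>. Both follow from one existence result
  (\<open>coherent_lexicographic_representation\<close>): every coherent set is contained in
  \<open>{g. A *v g >\<^sub>L 0}\<close> for some stochastic \<open>A\<close> of full rank. Indeed, if a nonzero \<open>f\<close> is outside
  \<open>K\<close>, then the cone generated by \<open>K\<close> and \<open>- f\<close> is still coherent (\<open>coherent_adjoin_uminus\<close>), and
  a matrix representing this larger cone belongs to \<open>credal_map K\<close> but gives \<open>A *v f <\<^sub>L 0\<close>. The
  zero gamble is outside the lozenge of any nonempty set.

  The rows of \<open>A\<close> are chosen one after the other. Let \<open>P\<close> be the set of rows already chosen. The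
  gambles of \<open>K\<close> orthogonal to \<open>P\<close> are those whose lexicographic sign is still undecided. They form
  a convex set without zero inside the orthogonal complement of \<open>P\<close>, so some nonzero vector of this
  complement has a non-negative inner product with all of them. This vector may have negative
  entries, but adding a large multiple of the sum of the rows in \<open>P\<close> repairs them without changing the values on
  undecided gambles: a coordinate on which all earlier rows vanish corresponds to an undecided unit
  vector, where the entry is non-negative already (\<open>lexicographic_row_exists\<close>). The new row is not
  in the span of \<open>P\<close>, so the final matrix has full rank and no nonzero gamble remains undecided.
\<close>

section \<open>The lexicographic order and the polar of a set of matrices\<close>

lemma first_nonzero_component:
  fixes h :: "real ^ 'n::{finite,linorder}"
  assumes "h \<noteq> 0"
  obtains k where "h $ k \<noteq> 0" "\<And>i. i < k \<Longrightarrow> h $ i = 0"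
proof -
  let ?D = "{i. h $ i \<noteq> 0}"
  have "?D \<noteq> {}" using assms by (auto simp: vec_eq_iff)
  then have "h $ Min ?D \<noteq> 0" using Min_in[of ?D] by simp
  moreover have "h $ i = 0" if "i < Min ?D" for i
    using that Min_le[of ?D i] by (auto simp: not_le[symmetric])
  ultimately show ?thesis using that by blast
qed

lemma zero_lex_less_iff:
  fixes h :: "real ^ 'n::{finite,linorder}"
  shows "h >\<^sub>L 0 \<longleftrightarrow> (\<exists>k. 0 < h $ k \<and> (\<forall>i<k. h $ i = 0))"
proof -
  have Min_eq: "Min {i. (0::real ^ 'n::{finite,linorder}) $ i \<noteq> h $ i} = k"
    if "h $ k \<noteq> 0" "\<And>i. i < k \<Longrightarrow> h $ i = 0" for k
  proof (rule Min_eqI)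
    show "k \<le> i" if "i \<in> {i. (0::real ^ 'n::{finite,linorder}) $ i \<noteq> h $ i}" for i
      using that \<open>\<And>i. i < k \<Longrightarrow> h $ i = 0\<close>[of i] by (auto simp: not_less[symmetric])
  qed (use that in auto)
  show ?thesis
  proof
    assume h: "h >\<^sub>L 0"
    then have "h \<noteq> 0" by (auto simp: lex_less_def)
    then obtain k where k: "h $ k \<noteq> 0" "\<And>i. i < k \<Longrightarrow> h $ i = 0"
      using first_nonzero_component by blast
    have "Min {i. (0::real ^ 'n::{finite,linorder}) $ i \<noteq> h $ i} = k"
      using k by (rule Min_eq)
    then have "0 < h $ k"
      using h unfolding lex_less_def Let_def by (metis zero_index)
    then show "\<exists>k. 0 < h $ k \<and> (\<forall>i<k. h $ i = 0)" using k(2) by blast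
  next
    assume "\<exists>k. 0 < h $ k \<and> (\<forall>i<k. h $ i = 0)"
    then obtain k where k: "0 < h $ k" "\<And>i. i < k \<Longrightarrow> h $ i = 0" by blast
    have "Min {i. (0::real ^ 'n::{finite,linorder}) $ i \<noteq> h $ i} = k"
      using k by (intro Min_eq) auto
    moreover have "0 \<noteq> h" using k(1) by auto
    ultimately show "h >\<^sub>L 0"
      using k(1) unfolding lex_less_def Let_def by simp
  qed
qed

lemma lex_pos_add:
  fixes g h :: "real ^ 'n::{finite,linorder}"
  assumes "g >\<^sub>L 0" "h >\<^sub>L 0"
  shows "g + h >\<^sub>L 0"
proof -
  obtain k l where k: "0 < g $ k" "\<forall>i<k. g $ i = 0" and l: "0 < h $ l" "\<forall>i<l. h $ i = 0"
    using assms by (auto simp: zero_lex_less_iff)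
  have "0 < (g + h) $ min k l"
    using k l by (cases k l rule: linorder_cases) (auto simp: min_def)
  moreover have "\<forall>i < min k l. (g + h) $ i = 0" using k l by auto
  ultimately show ?thesis by (auto simp: zero_lex_less_iff)
qed

lemma lex_pos_scaleR:
  fixes g :: "real ^ 'n::{finite,linorder}"
  assumes "g >\<^sub>L 0" "0 < c"
  shows "c *\<^sub>R g >\<^sub>L 0"
  using assms by (auto simp: zero_lex_less_iff zero_less_mult_iff intro!: exI)

lemma lex_pos_irrefl: "\<not> (0::real ^ 'n::{finite,linorder}) >\<^sub>L 0"
  by (simp add: lex_less_def)

lemma lex_pos_of_nonneg:
  fixes h :: "real ^ 'n::{finite,linorder}"
  assumes "\<And>i. 0 \<le> h $ i" "h \<noteq> 0"
  shows "h >\<^sub>L 0"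
proof -
  obtain k where "h $ k \<noteq> 0" "\<And>i. i < k \<Longrightarrow> h $ i = 0"
    using first_nonzero_component[OF assms(2)] by blast
  moreover from this have "0 < h $ k" using assms(1)[of k] by simp
  ultimately show ?thesis by (auto simp: zero_lex_less_iff)
qed

lemma full_rank_stochastic_mult_eq_0:
  fixes A :: "real ^ 'n::finite ^ 'n"
  assumes "A \<in> full_rank_stochastic" "A *v g = 0"
  shows "g = 0"
proof -
  have "inj ((*v) A)"
    using assms(1) full_rank_injective[of A] by (simp add: full_rank_stochastic_def)
  then show ?thesis
    using assms(2) by (metis injD matrix_vector_mult_0_right)
qed

lemma full_rank_stochastic_mult_lex_pos:
  fixes A :: "real ^ 'n::{finite,linorder} ^ 'n::{finite,linorder}"
  assumes A: "A \<in> full_rank_stochastic" and g: "g > 0"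
  shows "A *v g >\<^sub>L 0"
proof (rule lex_pos_of_nonneg)
  show "0 \<le> (A *v g) $ i" for i
    using A g
    by (auto simp: matrix_vector_mult_def full_rank_stochastic_def less_vec_def less_eq_vec_def
        intro!: sum_nonneg mult_nonneg_nonneg)
  show "A *v g \<noteq> 0"
    using full_rank_stochastic_mult_eq_0[OF A] g by blast
qed

lemma coherent_polar_gambles:
  fixes \<P> :: "(real ^ 'n::{finite,linorder} ^ 'n::{finite,linorder}) set"
  assumes "\<P> \<noteq> {}" "\<P> \<subseteq> full_rank_stochastic"
  shows "coherent (\<P>\<^sup>\<lozenge>)"
  unfolding coherent_def
proof (intro conjI ballI allI impI)
  show "g + f \<in> \<P>\<^sup>\<lozenge>" if "g \<in> \<P>\<^sup>\<lozenge>" "f \<in> \<P>\<^sup>\<lozenge>" for g f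
    using that by (simp add: polar_gambles_def matrix_vector_right_distrib lex_pos_add)
  show "c *\<^sub>R g \<in> \<P>\<^sup>\<lozenge>" if "g \<in> \<P>\<^sup>\<lozenge>" "0 < c" for g and c :: real
    using that by (simp add: polar_gambles_def matrix_vector_mult_scaleR lex_pos_scaleR)
  show "g \<in> \<P>\<^sup>\<lozenge>" if "0 < g" for g
    using that assms(2) full_rank_stochastic_mult_lex_pos by (auto simp: polar_gambles_def)
  show "0 \<notin> \<P>\<^sup>\<lozenge>"
    using assms(1) by (auto simp: polar_gambles_def lex_pos_irrefl)
qed

lemma credal_map_polar_gambles:
  assumes "L_credal_set \<P>"
  shows "credal_map (\<P>\<^sup>\<lozenge>) = \<P>"
proof -
  obtain S where S: "\<P> = {A. \<forall>g\<in>S. A *v g >\<^sub>L 0} \<inter> full_rank_stochastic"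
    using assms by (auto simp: L_credal_set_def L_convex_cone_def)
  then have "S \<subseteq> \<P>\<^sup>\<lozenge>" by (auto simp: polar_gambles_def)
  then show ?thesis
    using S by (auto simp: credal_map_def polar_matrices_def polar_gambles_def)
qed

section \<open>Coherent sets as convex cones\<close>

lemma coherent_axis:
  assumes "coherent K"
  shows "axis j (1::real) \<in> K"
proof -
  have "axis j (1::real) > 0"
    by (auto simp: less_vec_def less_eq_vec_def axis_def)
  then show ?thesis using assms by (auto simp: coherent_def)
qed

lemma coherent_convex:
  assumes "coherent K"
  shows "convex K"
  unfolding convex_alt
proof (intro ballI allI impI)
  fix x y and u :: real
  assume xy: "x \<in> K" "y \<in> K" and u: "0 \<le> u \<and> u \<le> 1"
  consider "u = 0" | "u = 1" | "0 < u" "0 < 1 - u" using u by force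
  then show "(1 - u) *\<^sub>R x + u *\<^sub>R y \<in> K"
    using assms xy by cases (auto simp: coherent_def)
qed

text \<open>
  The generated cone consists of the nonzero differences \<open>g - c *\<^sub>R f\<close> with \<open>c \<ge> 0\<close> and \<open>g\<close> zero
  or in \<open>K\<close>. The point is that two of them cannot cancel: if they do and some \<open>c\<close> is positive,
  then \<open>f\<close> is zero or a positive multiple of an element of \<open>K\<close>; otherwise both belong to \<open>K\<close>,
  which would then contain zero.
\<close>

lemma coherent_adjoin_uminus:
  fixes K :: "(real ^ 'n::finite) set"
  assumes K: "coherent K" and f: "f \<notin> K" "f \<noteq> 0"
  obtains K' where "coherent K'" "K \<subseteq> K'" "- f \<in> K'"
proof
  let ?K0 = "insert 0 K"
  let ?K' = "{x. x \<noteq> 0 \<and> (\<exists>c\<ge>0. x + c *\<^sub>R f \<in> ?K0)}"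
  have add: "g + h \<in> K" if "g \<in> K" "h \<in> K" for g h
    using K that by (simp add: coherent_def)
  have scale: "c *\<^sub>R g \<in> K" if "g \<in> K" "0 < c" for g and c :: real
    using K that by (simp add: coherent_def)
  have zero: "0 \<notin> K" using K by (simp add: coherent_def)
  have add0: "g + h \<in> ?K0" if "g \<in> ?K0" "h \<in> ?K0" for g h
    using that add by auto
  have scale0: "c *\<^sub>R g \<in> ?K0" if "g \<in> ?K0" "0 < c" for g and c :: real
    using that scale by auto
  have f0: "\<not> 0 < c" if "c *\<^sub>R f \<in> ?K0" for c :: real
    using scale0[OF that, of "inverse c"] f by auto
  show K_sub: "K \<subseteq> ?K'"
    using zero by (auto intro!: exI[of _ 0])
  show "- f \<in> ?K'" using f by (auto intro!: exI[of _ 1])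
  show "coherent ?K'"
    unfolding coherent_def
  proof (intro conjI ballI allI impI)
    fix x y assume "x \<in> ?K'" "y \<in> ?K'"
    then obtain c d where c: "x \<noteq> 0" "0 \<le> c" "x + c *\<^sub>R f \<in> ?K0"
      and d: "y \<noteq> 0" "0 \<le> d" "y + d *\<^sub>R f \<in> ?K0"
      by blast
    have eq: "(x + c *\<^sub>R f) + (y + d *\<^sub>R f) = x + y + (c + d) *\<^sub>R f"
      by (simp add: algebra_simps)
    have sum: "x + y + (c + d) *\<^sub>R f \<in> ?K0"
      using add0[OF c(3) d(3)] unfolding eq .
    have "x + y \<noteq> 0"
    proof
      assume xy: "x + y = 0"
      then have "(c + d) *\<^sub>R f \<in> ?K0" using sum by (metis add_0)
      then have "c = 0" "d = 0" using f0[of "c + d"] c d by auto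
      then have "x \<in> K" "y \<in> K" using c d by auto
      then show False using add[of x y] xy zero by simp
    qed
    then show "x + y \<in> ?K'" using sum c(2) d(2) add_nonneg_nonneg[of c d] by blast
  next
    fix x and a :: real assume "x \<in> ?K'" and a: "0 < a"
    then obtain c where c: "x \<noteq> 0" "0 \<le> c" "x + c *\<^sub>R f \<in> ?K0" by blast
    have eq: "a *\<^sub>R (x + c *\<^sub>R f) = a *\<^sub>R x + (a * c) *\<^sub>R f" by (simp add: algebra_simps)
    have "a *\<^sub>R x + (a * c) *\<^sub>R f \<in> ?K0"
      using scale0[OF c(3) a] unfolding eq .
    moreover have "0 \<le> a * c" "a *\<^sub>R x \<noteq> 0" using a c by auto
    ultimately show "a *\<^sub>R x \<in> ?K'" by blast
  next
    show "x \<in> ?K'" if "0 < x" for x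
      using that K K_sub by (auto simp: coherent_def)
    show "0 \<notin> ?K'" by simp
  qed
qed

section \<open>Lexicographic separation by a stochastic matrix\<close>

text \<open>
  Supporting hyperplanes inside the orthogonal complement of \<open>P\<close>: instead of working in the
  subspace, the convex set is thickened by \<open>span P\<close>. It still misses zero, and a linear functional
  bounded below on a nonempty set that is invariant under translations by \<open>span P\<close> vanishes on
  \<open>span P\<close>.
\<close>

lemma supporting_vector_in_orthogonal_complement:
  fixes C P :: "'a::euclidean_space set"
  assumes C: "convex C" "0 \<notin> C" and orth: "\<And>g p. g \<in> C \<Longrightarrow> p \<in> P \<Longrightarrow> p \<bullet> g = 0"
    and P: "span P \<noteq> UNIV"
  obtains a where "a \<noteq> 0" "\<And>p. p \<in> P \<Longrightarrow> p \<bullet> a = 0" "\<And>g. g \<in> C \<Longrightarrow> 0 \<le> a \<bullet> g"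
proof (cases "C = {}")
  case True
  obtain a where "a \<noteq> 0" "\<forall>x\<in>span P. a \<bullet> x = 0"
    using span_not_UNIV_orthogonal[OF P] by blast
  then show ?thesis
    using that[of a] True by (auto simp: inner_commute span_base)
next
  case False
  then obtain g0 where g0: "g0 \<in> C" by blast
  let ?T = "\<Union>g\<in>C. \<Union>w\<in>span P. {g + w}"
  have "convex ?T"
    by (rule convex_sums[OF C(1) subspace_imp_convex[OF subspace_span]])
  moreover have "0 \<notin> ?T"
  proof
    assume "0 \<in> ?T"
    then obtain g w where gw: "g \<in> C" "w \<in> span P" "g + w = 0" by auto
    have "orthogonal g w"
      using orthogonal_to_span[OF gw(2)] orth gw(1) by (auto simp: orthogonal_def inner_commute)
    moreover have "w = - g" using gw(3) by (simp add: add_eq_0_iff)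
    ultimately have "g = 0" by (simp add: orthogonal_def)
    then show False using gw C by simp
  qed
  ultimately obtain a where a: "a \<noteq> 0" "\<forall>x\<in>?T. 0 \<le> a \<bullet> x"
    using separating_hyperplane_set_0[of ?T] by auto
  have pos: "0 \<le> a \<bullet> g + a \<bullet> w" if "g \<in> C" "w \<in> span P" for g w
    using a(2) that by (force simp: inner_add_right[symmetric])
  have "p \<bullet> a = 0" if p: "p \<in> P" for p
  proof (rule ccontr)
    assume nz: "p \<bullet> a \<noteq> 0"
    \<comment> \<open>The multiple of \<open>p\<close> is chosen so that \<open>a\<close> takes the value \<open>-1\<close> on the translate of \<open>g0\<close>.\<close>
    let ?w = "(- (a \<bullet> g0 + 1) / (p \<bullet> a)) *\<^sub>R p"
    have "a \<bullet> ?w = - (a \<bullet> g0 + 1)" using nz by (simp add: inner_commute)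
    moreover have "?w \<in> span P" using p by (intro span_scale span_base)
    ultimately show False using pos[OF g0, of ?w] by simp
  qed
  moreover have "0 \<le> a \<bullet> g" if "g \<in> C" for g
    using pos[OF that span_zero] by simp
  ultimately show ?thesis using that a(1) by blast
qed

text \<open>
  The vector \<open>a\<close> supplied by the preceding lemma is turned into a probability mass function by adding
  \<open>c\<close> times the sum of \<open>P\<close> and normalising. Since \<open>a\<close> is orthogonal to \<open>P\<close> and nonzero, this keeps
  it outside \<open>span P\<close>.
\<close>

lemma lexicographic_row_exists:
  fixes K :: "(real ^ 'n::finite) set"
  assumes K: "coherent K" and P: "finite P" "span P \<noteq> UNIV"
    and nonneg: "\<And>p j. p \<in> P \<Longrightarrow> 0 \<le> p $ j"
  obtains q where "\<And>j. 0 \<le> q $ j" "(\<Sum>j\<in>UNIV. q $ j) = 1" "q \<notin> span P"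
    "\<And>g. g \<in> K \<Longrightarrow> (\<And>p. p \<in> P \<Longrightarrow> p \<bullet> g = 0) \<Longrightarrow> 0 \<le> q \<bullet> g"
proof -
  let ?C = "K \<inter> {g. \<forall>p\<in>P. p \<bullet> g = 0}"
  have "convex {g. \<forall>p\<in>P. p \<bullet> g = 0}"
    by (auto simp: convex_def inner_add_right)
  then have "convex ?C" using coherent_convex[OF K] by (intro convex_Int)
  moreover have "0 \<notin> ?C" using K by (simp add: coherent_def)
  ultimately obtain a where a: "a \<noteq> 0" and aP: "\<And>p. p \<in> P \<Longrightarrow> p \<bullet> a = 0"
    and aC: "\<And>g. g \<in> ?C \<Longrightarrow> 0 \<le> a \<bullet> g"
    using supporting_vector_in_orthogonal_complement[of ?C P, OF _ _ _ P(2)] by blast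
  define s where "s = \<Sum>P"
  \<comment> \<open>Division by zero yields zero, so only coordinates with \<open>s $ j > 0\<close> contribute. For these,
    \<open>c * s $ j \<ge> \<bar>a $ j\<bar>\<close>, so \<open>r $ j \<ge> 0\<close>.\<close>
  define c where "c = (\<Sum>j\<in>UNIV. \<bar>a $ j\<bar> / s $ j)"
  define r where "r = a + c *\<^sub>R s"
  have s_nth: "s $ j = (\<Sum>p\<in>P. p $ j)" for j by (simp add: s_def)
  have s_nonneg: "0 \<le> s $ j" for j by (auto simp: s_nth intro: sum_nonneg nonneg)
  have s_span: "s \<in> span P" by (auto simp: s_def intro: span_sum span_base)
  have r_nonneg: "0 \<le> r $ j" for j
  proof (cases "s $ j = 0")
    case True
    then have "axis j 1 \<in> ?C"
      using sum_nonneg_eq_0_iff[OF P(1), of "\<lambda>p. p $ j"] nonneg coherent_axis[OF K]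
      by (auto simp: s_nth inner_axis)
    then show ?thesis using aC[of "axis j 1"] True by (simp add: r_def inner_axis)
  next
    case False
    then have sj: "0 < s $ j" using s_nonneg[of j] by simp
    have "\<bar>a $ j\<bar> / s $ j \<le> c"
      unfolding c_def by (rule member_le_sum) (auto simp: s_nonneg)
    then have "\<bar>a $ j\<bar> \<le> c * s $ j" using sj by (simp add: field_simps)
    then show ?thesis by (simp add: r_def)
  qed
  have r_span: "r \<notin> span P"
  proof
    assume "r \<in> span P"
    then have "a \<in> span P"
      using span_diff[of r P "c *\<^sub>R s"] s_span by (simp add: r_def span_scale)
    then have "orthogonal a a"
      by (rule orthogonal_to_span) (simp add: orthogonal_def inner_commute aP)
    then show False using a by (simp add: orthogonal_def)
  qed
  have r_K: "0 \<le> r \<bullet> g" if g: "g \<in> K" "\<And>p. p \<in> P \<Longrightarrow> p \<bullet> g = 0" for g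
  proof -
    have "s \<bullet> g = 0" using g(2) by (simp add: s_def inner_sum_left)
    then show ?thesis using aC[of g] g by (simp add: r_def inner_add_left)
  qed
  define t where "t = (\<Sum>j\<in>UNIV. r $ j)"
  have "t \<noteq> 0"
  proof
    assume "t = 0"
    then have "r = 0"
      using sum_nonneg_eq_0_iff[of UNIV "\<lambda>j. r $ j"] r_nonneg by (auto simp: t_def vec_eq_iff)
    then show False using r_span span_zero by blast
  qed
  moreover have "0 \<le> t" unfolding t_def by (rule sum_nonneg) (rule r_nonneg)
  ultimately have t: "0 < t" by simp
  show ?thesis
  proof (rule that[of "inverse t *\<^sub>R r"])
    show "0 \<le> (inverse t *\<^sub>R r) $ j" for j using t r_nonneg by simp
    show "(\<Sum>j\<in>UNIV. (inverse t *\<^sub>R r) $ j) = 1"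
      using t by (simp add: sum_distrib_left[symmetric] t_def)
    show "inverse t *\<^sub>R r \<notin> span P"
    proof
      assume "inverse t *\<^sub>R r \<in> span P"
      from span_scale[OF this, of t] show False using t r_span by simp
    qed
    show "0 \<le> (inverse t *\<^sub>R r) \<bullet> g" if "g \<in> K" "\<And>p. p \<in> P \<Longrightarrow> p \<bullet> g = 0" for g
      using r_K[OF that] t by simp
  qed
qed

lemma independent_image_if_not_in_span_below:
  fixes p :: "'n::{finite,linorder} \<Rightarrow> 'a::euclidean_space"
  assumes "\<And>k. p k \<notin> span (p ` {..<k})"
  shows "independent (p ` S) \<and> card (p ` S) = card S"
  using finite[of S]
proof (induction S rule: finite_linorder_max_induct)
  case empty
  then show ?case by (simp add: independent_empty)
next
  case (insert b A)
  have "p ` A \<subseteq> p ` {..<b}" using insert.hyps by auto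
  then have "p b \<notin> span (p ` A)" using assms[of b] span_mono by blast
  moreover from this have "p b \<notin> p ` A" by (rule contra_subsetD[OF span_superset])
  moreover have "b \<notin> A" using insert.hyps by auto
  ultimately show ?case
    using insert by (simp add: independent_insert)
qed

text \<open>
  Well-founded recursion on the row index stacks the rows: row \<open>k\<close> is chosen for the set of
  all earlier rows. There are fewer than \<open>CARD('n)\<close> of these, so they never span the whole space.
\<close>

lemma coherent_lexicographic_representation:
  fixes K :: "(real ^ 'n::{finite,linorder}) set"
  assumes K: "coherent K"
  obtains A :: "real ^ 'n::{finite,linorder} ^ 'n::{finite,linorder}"
    where "A \<in> full_rank_stochastic" "\<And>g. g \<in> K \<Longrightarrow> A *v g >\<^sub>L 0"
proof -
  define good where "good = (\<lambda>(p :: 'n \<Rightarrow> real ^ 'n::{finite,linorder}) k (q :: real ^ 'n::{finite,linorder}).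
      (\<forall>j. 0 \<le> q $ j) \<and> (\<Sum>j\<in>UNIV. q $ j) = 1 \<and>
      q \<notin> span (p ` {..<k}) \<and> (\<forall>g\<in>K. (\<forall>i<k. p i \<bullet> g = 0) \<longrightarrow> 0 \<le> q \<bullet> g))"
  have "\<exists>p. \<forall>k::'n. good p k (p k)"
  proof (rule dependent_wf_choice[of "{(i, k). i < k}"])
    show "wf {(i::'n, k). i < k}"
      by (rule wf_subset[OF wf_measure[of "\<lambda>k. card {..<k}"]])
        (auto intro!: psubset_card_mono)
  next
    fix p p' :: "'n \<Rightarrow> real ^ 'n::{finite,linorder}" and k q
    assume "\<And>i. (i, k) \<in> {(i, k). i < k} \<Longrightarrow> p i = p' i"
    then have eq: "p i = p' i" if "i < k" for i using that by simp
    then have "p ` {..<k} = p' ` {..<k}" by auto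
    then show "good p k q = good p' k q" by (simp add: good_def eq cong: imp_cong)
  next
    fix k :: 'n and p :: "'n \<Rightarrow> real ^ 'n::{finite,linorder}"
    assume "\<And>i. (i, k) \<in> {(i, k). i < k} \<Longrightarrow> good p i (p i)"
    then have nonneg: "0 \<le> x $ j" if "x \<in> p ` {..<k}" for x j
      using that by (auto simp: good_def)
    have "dim (p ` {..<k}) \<le> card (p ` {..<k})" by (rule dim_le_card') simp
    also have "\<dots> \<le> card {..<k}" by (rule card_image_le) simp
    also have "\<dots> < CARD('n)" by (rule psubset_card_mono) auto
    finally have "span (p ` {..<k}) \<noteq> UNIV"
      by (metis dim_span dim_UNIV DIM_cart DIM_real mult.right_neutral less_irrefl)
    from lexicographic_row_exists[OF K finite_imageI[OF finite] this nonneg]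
    obtain q where "\<And>j. 0 \<le> q $ j" "(\<Sum>j\<in>UNIV. q $ j) = 1" "q \<notin> span (p ` {..<k})"
      "\<And>g. g \<in> K \<Longrightarrow> (\<And>x. x \<in> p ` {..<k} \<Longrightarrow> x \<bullet> g = 0) \<Longrightarrow> 0 \<le> q \<bullet> g"
      by metis
    then have "good p k q" by (auto simp: good_def)
    then show "\<exists>q. good p k q" by blast
  qed
  then obtain p where p: "\<And>k::'n. good p k (p k)" by blast
  define A :: "real ^ 'n::{finite,linorder} ^ 'n::{finite,linorder}" where "A = (\<chi> i. p i)"
  have "independent (range p)" "card (range p) = CARD('n)"
    using independent_image_if_not_in_span_below[of p UNIV] p by (auto simp: good_def)
  moreover have "rows A = range p" by (auto simp: rows_def row_def A_def)
  ultimately have "rank A = CARD('n)"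
    by (simp add: dim_eq_card_independent row_rank_def)
  then have A: "A \<in> full_rank_stochastic"
    using p by (simp add: full_rank_stochastic_def A_def good_def)
  have "A *v g >\<^sub>L 0" if g: "g \<in> K" for g
  proof -
    have Ag: "(A *v g) $ i = p i \<bullet> g" for i
      by (simp add: A_def matrix_vector_mult_def inner_vec_def)
    have "g \<noteq> 0" using g K by (auto simp: coherent_def)
    then have "A *v g \<noteq> 0" using full_rank_stochastic_mult_eq_0[OF A] by blast
    then obtain k where k: "p k \<bullet> g \<noteq> 0" "\<And>i. i < k \<Longrightarrow> p i \<bullet> g = 0"
      using first_nonzero_component[of "A *v g"] by (metis Ag)
    then have "0 \<le> p k \<bullet> g" using p[of k] g by (auto simp: good_def)
    then have "0 < p k \<bullet> g" using k(1) by simp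
    then show ?thesis using k(2) by (auto simp: zero_lex_less_iff Ag)
  qed
  with A show ?thesis using that by blast
qed

section \<open>The bipolar identity and the bijection\<close>

lemma credal_map_nonempty:
  fixes K :: "(real ^ 'n::{finite,linorder}) set"
  assumes "coherent K"
  shows "credal_map K \<noteq> {}"
proof -
  obtain A :: "real ^ 'n::{finite,linorder} ^ 'n::{finite,linorder}"
    where "A \<in> full_rank_stochastic" "\<And>g. g \<in> K \<Longrightarrow> A *v g >\<^sub>L 0"
    using coherent_lexicographic_representation[OF assms] by blast
  then have "A \<in> credal_map K" by (simp add: credal_map_def polar_matrices_def)
  then show ?thesis by blast
qed

lemma polar_gambles_credal_map:
  fixes K :: "(real ^ 'n::{finite,linorder}) set"
  assumes K: "coherent K"
  shows "(credal_map K)\<^sup>\<lozenge> = K"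
proof
  show "K \<subseteq> (credal_map K)\<^sup>\<lozenge>"
    by (auto simp: credal_map_def polar_matrices_def polar_gambles_def)
  show "(credal_map K)\<^sup>\<lozenge> \<subseteq> K"
  proof (rule subsetI, rule ccontr)
    fix f assume f: "f \<in> (credal_map K)\<^sup>\<lozenge>" "f \<notin> K"
    obtain B where "B \<in> credal_map K" using credal_map_nonempty[OF K] by blast
    then have "B *v f >\<^sub>L 0" using f(1) by (auto simp: polar_gambles_def)
    then have "f \<noteq> 0" using lex_pos_irrefl by auto
    then obtain K' where K': "coherent K'" "K \<subseteq> K'" "- f \<in> K'"
      using coherent_adjoin_uminus[OF K f(2)] by blast
    then obtain A :: "real ^ 'n::{finite,linorder} ^ 'n::{finite,linorder}"
      where A: "A \<in> full_rank_stochastic" "\<And>g. g \<in> K' \<Longrightarrow> A *v g >\<^sub>L 0"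
      using coherent_lexicographic_representation by blast
    then have "A \<in> credal_map K"
      using K'(2) by (auto simp: credal_map_def polar_matrices_def)
    then have "A *v f >\<^sub>L 0" using f(1) by (auto simp: polar_gambles_def)
    from lex_pos_add[OF this A(2)[OF K'(3)]] have "(0::real ^ 'n::{finite,linorder}) >\<^sub>L 0"
      by (simp flip: matrix_vector_right_distrib)
    then show False using lex_pos_irrefl by blast
  qed
qed

theorem theorem18:
  shows "bij_betw credal_map
           (coherent_sets :: (real ^ 'n::{finite,linorder}) set set)
           (L_credal_sets :: (real ^ 'n::{finite,linorder} ^ 'n::{finite,linorder}) set set)
       \<and> (\<forall>\<P> \<in> (L_credal_sets :: (real ^ 'n::{finite,linorder} ^ 'n::{finite,linorder}) set set).
            inv_into coherent_sets credal_map \<P> = \<P>\<^sup>\<lozenge>)"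
proof -
  let ?D = "coherent_sets :: (real ^ 'n::{finite,linorder}) set set"
  let ?G = "L_credal_sets :: (real ^ 'n::{finite,linorder} ^ 'n::{finite,linorder}) set set"
  have to_G: "credal_map K \<in> ?G" if "K \<in> ?D" for K
  proof -
    have "L_convex_cone (K\<^sup>\<bullet>)" unfolding L_convex_cone_def polar_matrices_def by blast
    then show ?thesis
      using that credal_map_nonempty[of K]
      unfolding coherent_sets_def L_credal_sets_def L_credal_set_def credal_map_def by blast
  qed
  have to_D: "\<P>\<^sup>\<lozenge> \<in> ?D" if "\<P> \<in> ?G" for \<P>
    using that coherent_polar_gambles[of \<P>]
    unfolding coherent_sets_def L_credal_sets_def L_credal_set_def by blast
  have left: "(credal_map K)\<^sup>\<lozenge> = K" if "K \<in> ?D" for K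
    using that polar_gambles_credal_map by (simp add: coherent_sets_def)
  have right: "credal_map (\<P>\<^sup>\<lozenge>) = \<P>" if "\<P> \<in> ?G" for \<P>
    using that credal_map_polar_gambles by (simp add: L_credal_sets_def)
  have bij: "bij_betw credal_map ?D ?G"
    using to_G to_D left right by (intro bij_betw_byWitness[where f' = polar_gambles]) auto
  have "inv_into ?D credal_map \<P> = \<P>\<^sup>\<lozenge>" if "\<P> \<in> ?G" for \<P>
    using bij_betw_imp_inj_on[OF bij] to_D[OF that] right[OF that] by (rule inv_into_f_eq)
  with bij show ?thesis by blast
qed

end
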